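(* Let $G$ and $\Gamma$ be countable groups, and let $G\curvearrowright(X,\mu)$ and $\Gamma\curvearrowright(X,\mu)$ be probability-measure-preserving ergodic actions on a standard probability space having the same orbits. Suppose that $\mathcal{F}$ is a sub-$\sigma$-algebra of $\mathcal{B}(X)$ that is both $G$-invariant and $\Gamma$-invariant, such that the transformation of $X$ associated to each $g\in G$ is $(\Gamma,\mathcal{F})$-expressible and the transformation of $X$ associated to each $\gamma\in\Gamma$ is $(G,\mathcal{F})$-expressible. Then $$h^{\mathrm{Rok}}_G(X,\mu\mid\mathcal{F})=h^{\mathrm{Rok}}_\Gamma(X,\mu\mid\mathcal{F}).$$
   Context: Null sets are ignored: equalities of sets and of $\sigma$-algebras are modulo $\mu$-null sets, and a (countable Borel) partition is a countable collection of pairwise disjoint Borel sets (possibly empty) with conull union. $\mathcal{B}(X)$ is the Borel $\sigma$-algebra. For $\xi\subseteq\mathcal{B}(X)$, $\sigma\text{-}\mathrm{alg}_G(\xi)$ is the smallest $G$-invariant $\sigma$-algebra containing $\xi$; $\vee$ denotes the $\sigma$-algebra generated by the union. For a p.m.p. action $G\curvearrowright(X,\mu)$, $E_G^X=\{(x,y) : \exists g\in G,\ g\cdot x=y\}$, and the pseudo-group $[[E_G^X]]$ is the set of Borel bijections $\theta:\mathrm{dom}(\theta)\to\mathrm{rng}(\theta)$ between Borel subsets of $X$ with $\theta(x)\in G\cdot x$ for every $x\in\mathrm{dom}(\theta)$. For a $G$-invariant sub-$\sigma$-algebra $\mathcal{F}$, $\theta\in[[E_G^X]]$ is $(G,\mathcal{F})$-expressible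 if $\mathrm{dom}(\theta),\mathrm{rng}(\theta)\in\mathcal{F}$ and there is an $\mathcal{F}$-measurable partition $\{Z_g^\theta : g\in G\}$ of $\mathrm{dom}(\theta)$ such that $\theta(x)=g\cdot x$ for every $g\in G$ and $x\in Z_g^\theta$. When $G$ and $\Gamma$ have the same orbits, $E_G^X=E_\Gamma^X$, and $(\Gamma,\mathcal{F})$-expressibility is the same notion for the action of $\Gamma$. Conditional Shannon entropy: let $\pi:(X,\mu)\to(Y,\nu)$ be the factor map associated to $\mathcal{F}$ and $\mu=\int_Y\mu_y\,d\nu(y)$ the disintegration. For a countable Borel partition $\alpha$, $\mathrm{H}(\alpha\mid\mathcal{F})=\int_Y\sum_{A\in\alpha}-\mu_y(A)\log\mu_y(A)\,d\nu(y)$. Relative Rokhlin entropy of an ergodic action: $h^{\mathrm{Rok}}_G(X,\mu\mid\mathcal{F})=\inf\{\mathrm{H}(\alpha\mid\mathcal{F}) : \alpha$ a countable Borel partition of $X$ with $\sigma\text{-}\mathrm{alg}_G(\alpha)\vee\mathcal{F}=\mathcal{B}(X)\}$, and similarly for $\Gamma$. *)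

theory Defs
  imports "HOL-Probability.Probability" "HOL-Algebra.Group_Action"
begin

subsection \<open>Standard Borel and standard probability spaces\<close>

definition standard_borel :: "'x measure \<Rightarrow> bool" where
  "standard_borel M \<longleftrightarrow>
     (\<exists>T. completely_metrizable_space T \<and> second_countable T \<and> topspace T = space M \<and>
          sets M = sigma_sets (space M) {U. openin T U})"

definition standard_prob_space :: "'x measure \<Rightarrow> bool" where
  "standard_prob_space M \<longleftrightarrow> prob_space M \<and> standard_borel M"

subsection \<open>Collections of Borel sets modulo null sets\<close>

text \<open>
  Null sets are ignored by passing to the largest representative: \<open>mod_null M S\<close> consists of
  all Borel sets that agree with a member of \<open>S\<close> up to a null set.
  ``\<open>A \<in> S\<close> modulo null sets'' is \<open>A \<in> mod_null M S\<close>.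
\<close>

definition mod_null :: "'x measure \<Rightarrow> 'x set set \<Rightarrow> 'x set set" where
  "mod_null M S = {A \<in> sets M. \<exists>B\<in>S. sym_diff A B \<in> null_sets M}"

definition eq_mod_null :: "'x measure \<Rightarrow> 'x set set \<Rightarrow> 'x set set \<Rightarrow> bool" where
  "eq_mod_null M S T \<longleftrightarrow> mod_null M S = mod_null M T"

definition partition_mod_null :: "'x measure \<Rightarrow> 'x set set \<Rightarrow> bool" where
  "partition_mod_null M \<alpha> \<longleftrightarrow>
     countable \<alpha> \<and> \<alpha> \<subseteq> sets M \<and> disjoint \<alpha> \<and> space M - \<Union>\<alpha> \<in> null_sets M"

subsection \<open>Actions\<close>

definition pmp_action ::
    "'x measure \<Rightarrow> ('g, 'a) monoid_scheme \<Rightarrow> ('g \<Rightarrow> 'x \<Rightarrow> 'x) \<Rightarrow> bool" where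
  "pmp_action M G \<phi> \<longleftrightarrow> group_action G (space M) \<phi> \<and>
     (\<forall>g\<in>carrier G. \<phi> g \<in> measurable M M \<and> distr M M (\<phi> g) = M)"

definition ergodic_action ::
    "'x measure \<Rightarrow> ('g, 'a) monoid_scheme \<Rightarrow> ('g \<Rightarrow> 'x \<Rightarrow> 'x) \<Rightarrow> bool" where
  "ergodic_action M G \<phi> \<longleftrightarrow>
     (\<forall>A\<in>sets M. (\<forall>g\<in>carrier G. \<phi> g ` A = A) \<longrightarrow>
        A \<in> null_sets M \<or> space M - A \<in> null_sets M)"

text \<open>Orbit equality is an equality modulo null sets, hence required almost everywhere.\<close>

definition same_orbits ::
    "'x measure \<Rightarrow> ('g, 'a) monoid_scheme \<Rightarrow> ('g \<Rightarrow> 'x \<Rightarrow> 'x) \<Rightarrow>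
     ('h, 'b) monoid_scheme \<Rightarrow> ('h \<Rightarrow> 'x \<Rightarrow> 'x) \<Rightarrow> bool" where
  "same_orbits M G \<phi> H \<psi> \<longleftrightarrow> (AE x in M. orbit G \<phi> x = orbit H \<psi> x)"

definition invariant_collection ::
    "('g, 'a) monoid_scheme \<Rightarrow> ('g \<Rightarrow> 'x \<Rightarrow> 'x) \<Rightarrow> 'x set set \<Rightarrow> bool" where
  "invariant_collection G \<phi> S \<longleftrightarrow> (\<forall>g\<in>carrier G. \<forall>A\<in>S. \<phi> g ` A \<in> S)"

text \<open>
  The smallest invariant \<open>\<sigma>\<close>-algebra is formed pointwise.  As invariance modulo null sets is
  invariance of the largest representative, for countable \<open>G\<close> it represents the smallest invariant
  \<open>\<sigma>\<close>-algebra modulo null sets.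
\<close>

definition sigma_alg ::
    "'x measure \<Rightarrow> ('g, 'a) monoid_scheme \<Rightarrow> ('g \<Rightarrow> 'x \<Rightarrow> 'x) \<Rightarrow> 'x set set \<Rightarrow> 'x set set" where
  "sigma_alg M G \<phi> \<xi> =
     \<Inter>{S. sigma_algebra (space M) S \<and> S \<subseteq> sets M \<and> \<xi> \<subseteq> S \<and> invariant_collection G \<phi> S}"

definition sigma_join :: "'x measure \<Rightarrow> 'x set set \<Rightarrow> 'x set set \<Rightarrow> 'x set set" where
  "sigma_join M S T = sigma_sets (space M) (S \<union> T)"

subsection \<open>The pseudo-group and expressibility\<close>

text \<open>
  A partial transformation is given by its domain \<open>D\<close> and a total function \<open>\<theta>\<close>, whose values
  outside \<open>D\<close> are irrelevant; its range is \<open>\<theta> ` D\<close>.  In line with \<open>same_orbits\<close>, the condition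
  that \<open>\<theta>\<close> moves points within their orbits is required almost everywhere.
\<close>

definition in_pseudogroup ::
    "'x measure \<Rightarrow> ('g, 'a) monoid_scheme \<Rightarrow> ('g \<Rightarrow> 'x \<Rightarrow> 'x) \<Rightarrow> 'x set \<Rightarrow> ('x \<Rightarrow> 'x) \<Rightarrow> bool" where
  "in_pseudogroup M G \<phi> D \<theta> \<longleftrightarrow>
     D \<in> sets M \<and> \<theta> ` D \<in> sets M \<and> inj_on \<theta> D \<and> \<theta> \<in> measurable (restrict_space M D) M \<and>
     (AE x in M. x \<in> D \<longrightarrow> \<theta> x \<in> orbit G \<phi> x)"

definition expressible ::
    "'x measure \<Rightarrow> ('g, 'a) monoid_scheme \<Rightarrow> ('g \<Rightarrow> 'x \<Rightarrow> 'x) \<Rightarrow> 'x measure \<Rightarrow>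
     'x set \<Rightarrow> ('x \<Rightarrow> 'x) \<Rightarrow> bool" where
  "expressible M G \<phi> F D \<theta> \<longleftrightarrow>
     in_pseudogroup M G \<phi> D \<theta> \<and>
     D \<in> mod_null M (sets F) \<and> \<theta> ` D \<in> mod_null M (sets F) \<and>
     (\<exists>Z. (\<forall>g\<in>carrier G. Z g \<in> mod_null M (sets F) \<and> Z g \<subseteq> D) \<and>
          disjoint_family_on Z (carrier G) \<and>
          D - (\<Union>g\<in>carrier G. Z g) \<in> null_sets M \<and>
          (\<forall>g\<in>carrier G. \<forall>x\<in>Z g. \<theta> x = \<phi> g x))"

subsection \<open>Conditional Shannon entropy\<close>

definition factor_map ::
    "'x measure \<Rightarrow> 'x measure \<Rightarrow> 'y measure \<Rightarrow> ('x \<Rightarrow> 'y) \<Rightarrow> bool" where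
  "factor_map M F N \<pi> \<longleftrightarrow>
     standard_prob_space N \<and> \<pi> \<in> measurable M N \<and> distr M N \<pi> = N \<and>
     eq_mod_null M {\<pi> -` B \<inter> space M | B. B \<in> sets N} (sets F)"

definition disintegration ::
    "'x measure \<Rightarrow> 'y measure \<Rightarrow> ('x \<Rightarrow> 'y) \<Rightarrow> ('y \<Rightarrow> 'x measure) \<Rightarrow> bool" where
  "disintegration M N \<pi> \<kappa> \<longleftrightarrow>
     \<kappa> \<in> measurable N (prob_algebra M) \<and> M = N \<bind> \<kappa> \<and>
     (AE y in N. AE x in \<kappa> y. \<pi> x = y)"

definition fibre_entropy ::
    "'y measure \<Rightarrow> ('y \<Rightarrow> 'x measure) \<Rightarrow> 'x set set \<Rightarrow> ennreal" where
  "fibre_entropy N \<kappa> \<alpha> =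
     (\<integral>\<^sup>+y. (\<integral>\<^sup>+A. ennreal (- measure (\<kappa> y) A * ln (measure (\<kappa> y) A)) \<partial>count_space \<alpha>) \<partial>N)"

text \<open>
  The factor \<open>Y\<close> is realised on the type \<^typ>\<open>real\<close>, as every standard Borel space is isomorphic
  to a Borel subset of the line.  A factor and a disintegration exist by Rokhlin's theorem, which
  is not proved here; that the value does not depend on their choice is proved in
  \<open>fibre_entropy_unique\<close> and \<open>cond_entropy_eq\<close> below.
\<close>

definition cond_entropy :: "'x measure \<Rightarrow> 'x measure \<Rightarrow> 'x set set \<Rightarrow> ennreal" where
  "cond_entropy M F \<alpha> =
     (THE h. \<exists>(N :: real measure) \<pi> \<kappa>.
        factor_map M F N \<pi> \<and> disintegration M N \<pi> \<kappa> \<and> h = fibre_entropy N \<kappa> \<alpha>)"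

definition rokhlin_entropy ::
    "'x measure \<Rightarrow> ('g, 'a) monoid_scheme \<Rightarrow> ('g \<Rightarrow> 'x \<Rightarrow> 'x) \<Rightarrow> 'x measure \<Rightarrow> ennreal" where
  "rokhlin_entropy M G \<phi> F =
     (INF \<alpha> \<in> {\<alpha>. partition_mod_null M \<alpha> \<and>
                 eq_mod_null M (sigma_join M (sigma_alg M G \<phi> \<alpha>) (sets F)) (sets M)}.
        cond_entropy M F \<alpha>)"

subsection \<open>The conditional entropy is well defined\<close>

lemma sigma_algebra_mod_null:
  assumes "subalgebra M F"
  shows "sigma_algebra (space M) (mod_null M (sets F))"
proof -
  have sp: "space F = space M" and sub: "sets F \<subseteq> sets M"
    using assms by (auto simp: subalgebra_def)
  show ?thesis
    unfolding sigma_algebra_iff2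
  proof (intro conjI ballI allI impI)
    show "mod_null M (sets F) \<subseteq> Pow (space M)"
      by (auto simp: mod_null_def dest: sets.sets_into_space)
    show "{} \<in> mod_null M (sets F)"
      by (auto simp: mod_null_def intro!: bexI[of _ "{}"])
  next
    fix A assume "A \<in> mod_null M (sets F)"
    then obtain B where A: "A \<in> sets M" and B: "B \<in> sets F" "sym_diff A B \<in> null_sets M"
      by (auto simp: mod_null_def)
    have "sym_diff (space M - A) (space M - B) = sym_diff A B"
      using sets.sets_into_space[OF A] sets.sets_into_space[OF B(1)] sp by auto
    moreover have "space M - B \<in> sets F" using B(1) sp by (metis sets.compl_sets)
    ultimately show "space M - A \<in> mod_null M (sets F)"
      using A B(2) by (auto simp: mod_null_def intro!: bexI[of _ "space M - B"])
  next
    fix A :: "nat \<Rightarrow> _" assume "range A \<subseteq> mod_null M (sets F)"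
    then have "\<forall>i. A i \<in> sets M \<and> (\<exists>B\<in>sets F. sym_diff (A i) B \<in> null_sets M)"
      by (auto simp: mod_null_def)
    then obtain B where A: "\<And>i. A i \<in> sets M" and B: "\<And>i. B i \<in> sets F"
      and d: "\<And>i. sym_diff (A i) (B i) \<in> null_sets M" by metis
    have n: "(\<Union>i. sym_diff (A i) (B i)) \<in> null_sets M" by (rule null_sets_UN) (rule d)
    have BM: "B i \<in> sets M" for i using B sub by auto
    have m: "sym_diff (\<Union>i. A i) (\<Union>i. B i) \<in> sets M"
      using A BM by (intro sets.Un sets.Diff sets.countable_UN) auto
    have "sym_diff (\<Union>i. A i) (\<Union>i. B i) \<in> null_sets M"
      by (rule null_sets_subset[OF n m]) auto
    moreover have "(\<Union>i. B i) \<in> sets F" using B by auto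
    moreover have "(\<Union>i. A i) \<in> sets M" using A by auto
    ultimately show "(\<Union>i. A i) \<in> mod_null M (sets F)"
      unfolding mod_null_def by blast
  qed
qed

lemma disintegration_cond_exp:
  assumes M: "prob_space M" and F: "subalgebra M F"
    and f: "factor_map M F N \<pi>" and d: "disintegration M N \<pi> \<kappa>" and A: "A \<in> sets M"
  defines "F' \<equiv> sigma (space M) (mod_null M (sets F))"
  shows "AE x in M. nn_cond_exp M F' (indicator A) x = emeasure (\<kappa> (\<pi> x)) A"
proof -
  interpret M: prob_space M by fact
  interpret SA: sigma_algebra "space M" "mod_null M (sets F)"
    by (rule sigma_algebra_mod_null[OF F])
  have sF': "sets F' = mod_null M (sets F)" "space F' = space M"
    by (auto simp: F'_def SA.sigma_sets_eq SA.space_closed sets_measure_of_conv)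
  have subF': "subalgebra M F'" by (auto simp: subalgebra_def sF' mod_null_def)
  interpret finite_measure_subalgebra M F' by unfold_locales (rule subF')
  have \<pi>[measurable]: "\<pi> \<in> measurable M N" and dist: "distr M N \<pi> = N"
    and N: "prob_space N"
    and e: "mod_null M {\<pi> -` B \<inter> space M | B. B \<in> sets N} = mod_null M (sets F)"
    using f by (auto simp: factor_map_def standard_prob_space_def eq_mod_null_def)
  have \<kappa>[measurable]: "\<kappa> \<in> measurable N (prob_algebra M)" and b: "M = N \<bind> \<kappa>"
    and fib: "AE y in N. AE x in \<kappa> y. \<pi> x = y"
    using d by (auto simp: disintegration_def)
  have \<kappa>s[measurable]: "\<kappa> \<in> measurable N (subprob_algebra M)"
    by (rule measurable_prob_algebraD) (rule \<kappa>)
  have set_\<kappa>: "sets (\<kappa> y) = sets M" if "y \<in> space N" for y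
    using measurable_space[OF \<kappa> that] by (auto simp: space_prob_algebra)
  note A[measurable]
  have em[measurable]: "(\<lambda>y. emeasure (\<kappa> y) A) \<in> borel_measurable N" by measurable
  have pre: "\<pi> -` B \<inter> space M \<in> sets F'" if "B \<in> sets N" for B
  proof -
    have "\<pi> -` B \<inter> space M \<in> mod_null M {\<pi> -` B \<inter> space M | B. B \<in> sets N}"
      using that unfolding mod_null_def
      by (intro CollectI conjI bexI[of _ "\<pi> -` B \<inter> space M"]) (auto intro: measurable_sets)
    then show ?thesis using e sF' by simp
  qed
  have \<pi>F: "\<pi> \<in> measurable F' N"
    by (rule measurableI) (use pre measurable_space[OF \<pi>] sF' in auto)
  have "AE x in M. emeasure (\<kappa> (\<pi> x)) A = nn_cond_exp M F' (indicator A) x"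
  proof (rule nn_cond_exp_charact)
    show "(indicator A :: _ \<Rightarrow> ennreal) \<in> borel_measurable M" by simp
    show "(\<lambda>x. emeasure (\<kappa> (\<pi> x)) A) \<in> borel_measurable F'"
      by (rule measurable_compose[OF \<pi>F em])
    fix B assume "B \<in> sets F'"
    then have "B \<in> mod_null M {\<pi> -` B \<inter> space M | B. B \<in> sets N}" using e sF' by simp
    then obtain C where C[measurable]: "C \<in> sets N" and B[measurable]: "B \<in> sets M"
      and n: "sym_diff B (\<pi> -` C \<inter> space M) \<in> null_sets M"
      by (auto simp: mod_null_def)
    have ae: "AE x in M. x \<in> B \<longleftrightarrow> \<pi> x \<in> C"
      using AE_not_in[OF n] AE_space by eventually_elim auto
    have AC: "A \<inter> (\<pi> -` C \<inter> space M) \<in> sets M" using A by measurable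
    have "(\<integral>\<^sup>+x\<in>B. indicator A x \<partial>M) = (\<integral>\<^sup>+x. indicator (A \<inter> (\<pi> -` C \<inter> space M)) x \<partial>M)"
    proof (rule nn_integral_cong_AE)
      show "AE x in M. indicator A x * indicator B x =
              (indicator (A \<inter> (\<pi> -` C \<inter> space M)) x :: ennreal)"
        using ae AE_space by eventually_elim (auto split: split_indicator)
    qed
    also have "\<dots> = emeasure M (A \<inter> (\<pi> -` C \<inter> space M))" using AC by simp
    also have "\<dots> = emeasure (N \<bind> \<kappa>) (A \<inter> (\<pi> -` C \<inter> space M))" using b by simp
    also have "\<dots> = (\<integral>\<^sup>+y. emeasure (\<kappa> y) (A \<inter> (\<pi> -` C \<inter> space M)) \<partial>N)"
      using N prob_space.not_empty[OF N] by (intro emeasure_bind[OF _ \<kappa>s AC]) auto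
    also have "\<dots> = (\<integral>\<^sup>+y\<in>C. emeasure (\<kappa> y) A \<partial>N)"
    proof (rule nn_integral_cong_AE)
      show "AE y in N. emeasure (\<kappa> y) (A \<inter> (\<pi> -` C \<inter> space M)) = emeasure (\<kappa> y) A * indicator C y"
        using fib AE_space
      proof eventually_elim
        case (elim y)
        have s: "sets (\<kappa> y) = sets M" and sp: "space (\<kappa> y) = space M"
          using set_\<kappa>[OF elim(2)] sets_eq_imp_space_eq by blast+
        show ?case
        proof (cases "y \<in> C")
          case True
          have "AE x in \<kappa> y. x \<in> A \<inter> (\<pi> -` C \<inter> space M) \<longleftrightarrow> x \<in> A"
            using elim(1) AE_space[of "\<kappa> y"] by eventually_elim (use True sp in auto)
          then have "emeasure (\<kappa> y) (A \<inter> (\<pi> -` C \<inter> space M)) = emeasure (\<kappa> y) A"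
            by (rule emeasure_eq_AE) (use s AC A in auto)
          then show ?thesis using True by simp
        next
          case False
          have "AE x in \<kappa> y. x \<in> A \<inter> (\<pi> -` C \<inter> space M) \<longleftrightarrow> x \<in> {}"
            using elim(1) by eventually_elim (use False in auto)
          then have "emeasure (\<kappa> y) (A \<inter> (\<pi> -` C \<inter> space M)) = emeasure (\<kappa> y) {}"
            by (rule emeasure_eq_AE) (use s AC in auto)
          then show ?thesis using False by simp
        qed
      qed
    qed
    also have "\<dots> = (\<integral>\<^sup>+y\<in>C. emeasure (\<kappa> y) A \<partial>distr M N \<pi>)" using dist by simp
    also have "\<dots> = (\<integral>\<^sup>+x. emeasure (\<kappa> (\<pi> x)) A * indicator C (\<pi> x) \<partial>M)"
      by (subst nn_integral_distr) auto
    also have "\<dots> = (\<integral>\<^sup>+x\<in>B. emeasure (\<kappa> (\<pi> x)) A \<partial>M)"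
    proof (rule nn_integral_cong_AE)
      show "AE x in M. emeasure (\<kappa> (\<pi> x)) A * indicator C (\<pi> x) =
              emeasure (\<kappa> (\<pi> x)) A * indicator B x"
        using ae by eventually_elim (auto split: split_indicator)
    qed
    finally show "(\<integral>\<^sup>+x\<in>B. indicator A x \<partial>M) = (\<integral>\<^sup>+x\<in>B. emeasure (\<kappa> (\<pi> x)) A \<partial>M)" .
  qed
  then show ?thesis by eventually_elim simp
qed

lemma fibre_entropy_eq_cond_exp:
  assumes M: "prob_space M" and F: "subalgebra M F"
    and f: "factor_map M F N \<pi>" and d: "disintegration M N \<pi> \<kappa>" and \<alpha>: "partition_mod_null M \<alpha>"
  defines "p \<equiv> \<lambda>A x. enn2real (nn_cond_exp M (sigma (space M) (mod_null M (sets F))) (indicator A) x)"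
  shows "fibre_entropy N \<kappa> \<alpha> = (\<integral>\<^sup>+x. (\<integral>\<^sup>+A. ennreal (- p A x * ln (p A x)) \<partial>count_space \<alpha>) \<partial>M)"
proof -
  have c: "countable \<alpha>" and s: "\<alpha> \<subseteq> sets M" using \<alpha> by (auto simp: partition_mod_null_def)
  have \<pi>[measurable]: "\<pi> \<in> measurable M N" and dist: "distr M N \<pi> = N"
    using f by (auto simp: factor_map_def)
  have [measurable]: "\<kappa> \<in> measurable N (subprob_algebra M)"
    using d by (auto simp: disintegration_def intro: measurable_prob_algebraD)
  let ?h = "\<lambda>y A. ennreal (- measure (\<kappa> y) A * ln (measure (\<kappa> y) A))"
  have m1: "(\<lambda>y. ?h y A) \<in> borel_measurable N" if "A \<in> \<alpha>" for A
  proof -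
    have [measurable]: "A \<in> sets M" using that s by auto
    show ?thesis by measurable
  qed
  have m: "(\<lambda>y. \<integral>\<^sup>+A. ?h y A \<partial>count_space \<alpha>) \<in> borel_measurable N"
  proof (rule sigma_finite_measure.borel_measurable_nn_integral)
    show "sigma_finite_measure (count_space \<alpha>)"
      by (rule sigma_finite_measure_count_space_countable[OF c])
    have "(\<lambda>(A, y). ?h y A) \<in> borel_measurable (count_space \<alpha> \<Otimes>\<^sub>M N)"
      by (rule measurable_pair_measure_countable1[OF c]) (use m1 in simp)
    then show "case_prod ?h \<in> borel_measurable (N \<Otimes>\<^sub>M count_space \<alpha>)"
      by (subst measurable_pair_swap_iff) (simp add: case_prod_beta)
  qed
  have "AE x in M. \<forall>A\<in>\<alpha>. nn_cond_exp M (sigma (space M) (mod_null M (sets F))) (indicator A) x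
          = emeasure (\<kappa> (\<pi> x)) A"
    using disintegration_cond_exp[OF M F f d] s c by (intro AE_ball_countable') auto
  then have ae: "AE x in M. \<forall>A\<in>\<alpha>. measure (\<kappa> (\<pi> x)) A = p A x"
    by eventually_elim (auto simp: p_def measure_def)
  have "fibre_entropy N \<kappa> \<alpha> = (\<integral>\<^sup>+y. (\<integral>\<^sup>+A. ?h y A \<partial>count_space \<alpha>) \<partial>distr M N \<pi>)"
    by (simp add: fibre_entropy_def dist)
  also have "\<dots> = (\<integral>\<^sup>+x. (\<integral>\<^sup>+A. ?h (\<pi> x) A \<partial>count_space \<alpha>) \<partial>M)"
    by (rule nn_integral_distr[OF \<pi>]) (use m dist in auto)
  also have "\<dots> = (\<integral>\<^sup>+x. (\<integral>\<^sup>+A. ennreal (- p A x * ln (p A x)) \<partial>count_space \<alpha>) \<partial>M)"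
  proof (rule nn_integral_cong_AE)
    show "AE x in M. (\<integral>\<^sup>+A. ?h (\<pi> x) A \<partial>count_space \<alpha>) =
            (\<integral>\<^sup>+A. ennreal (- p A x * ln (p A x)) \<partial>count_space \<alpha>)"
      using ae by eventually_elim (auto intro!: nn_integral_cong)
  qed
  finally show ?thesis .
qed

lemma fibre_entropy_unique:
  fixes N :: "'y measure" and N' :: "'z measure"
  assumes "prob_space M" "subalgebra M F" "partition_mod_null M \<alpha>"
    and "factor_map M F N \<pi>" "disintegration M N \<pi> \<kappa>"
    and "factor_map M F N' \<pi>'" "disintegration M N' \<pi>' \<kappa>'"
  shows "fibre_entropy N \<kappa> \<alpha> = fibre_entropy N' \<kappa>' \<alpha>"
  by (rule trans[OF fibre_entropy_eq_cond_exp[OF assms(1,2,4,5,3)]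
        fibre_entropy_eq_cond_exp[OF assms(1,2,6,7,3), symmetric]])

lemma cond_entropy_eq:
  fixes N :: "real measure"
  assumes "prob_space M" "subalgebra M F" "partition_mod_null M \<alpha>"
    and "factor_map M F N \<pi>" "disintegration M N \<pi> \<kappa>"
  shows "cond_entropy M F \<alpha> = fibre_entropy N \<kappa> \<alpha>"
  unfolding cond_entropy_def
proof (rule the_equality)
  show "\<exists>(N' :: real measure) \<pi>' \<kappa>'. factor_map M F N' \<pi>' \<and> disintegration M N' \<pi>' \<kappa>' \<and>
          fibre_entropy N \<kappa> \<alpha> = fibre_entropy N' \<kappa>' \<alpha>"
    using assms(4,5) by blast
next
  fix h
  assume "\<exists>(N' :: real measure) \<pi>' \<kappa>'. factor_map M F N' \<pi>' \<and> disintegration M N' \<pi>' \<kappa>' \<and>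
            h = fibre_entropy N' \<kappa>' \<alpha>"
  then obtain N' :: "real measure" and \<pi>' \<kappa>'
    where *: "factor_map M F N' \<pi>'" "disintegration M N' \<pi>' \<kappa>'" "h = fibre_entropy N' \<kappa>' \<alpha>"
    by blast
  show "h = fibre_entropy N \<kappa> \<alpha>"
    unfolding *(3) by (rule fibre_entropy_unique[OF assms(1-3) *(1,2) assms(4,5)])
qed

end

theory Submission
  imports Defs
begin

text \<open>
  Neither the conditional entropy nor the class of partitions mentions the group, so it suffices
  that \<open>\<alpha>\<close> generates relative to \<open>\<F>\<close> under \<open>G\<close> iff it does under \<open>\<Gamma>\<close>.  Modulo null sets,
  \<open>\<sigma>-alg\<^sub>G(\<alpha>) \<or> \<F>\<close> is \<open>G\<close>-invariant and contains the pieces \<open>Z\<^sub>g\<close> on which a given \<open>\<gamma> \<in> \<Gamma>\<close> acts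
  as \<open>g\<close>.  Hence with \<open>A\<close> it contains \<open>\<gamma> A = \<Union>\<^sub>g g (A \<inter> Z\<^sub>g)\<close>, so it is \<open>\<Gamma>\<close>-invariant and
  contains \<open>\<sigma>-alg\<^sub>\<Gamma>(\<alpha>) \<or> \<F>\<close>; the converse is symmetric.
\<close>

section \<open>Saturation of set collections under null sets\<close>

lemma mod_nullI: "A \<in> sets M \<Longrightarrow> B \<in> S \<Longrightarrow> sym_diff A B \<in> null_sets M \<Longrightarrow> A \<in> mod_null M S"
  by (auto simp: mod_null_def)

lemma mod_null_subset_sets: "mod_null M S \<subseteq> sets M"
  by (auto simp: mod_null_def)

lemma mod_null_mono: "S \<subseteq> T \<Longrightarrow> mod_null M S \<subseteq> mod_null M T"
  by (auto simp: mod_null_def)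

lemma subset_mod_null: "S \<subseteq> sets M \<Longrightarrow> S \<subseteq> mod_null M S"
  by (auto intro!: mod_nullI)

text \<open>Null errors add up: \<open>sym_diff A C\<close> lies in the union of
  \<open>sym_diff A B\<close> and \<open>sym_diff B C\<close>. The assumption on \<open>S\<close>
  makes it measurable.\<close>

lemma mod_null_idem:
  assumes "S \<subseteq> sets M"
  shows "mod_null M (mod_null M S) = mod_null M S"
proof
  show "mod_null M S \<subseteq> mod_null M (mod_null M S)"
    by (rule subset_mod_null[OF mod_null_subset_sets])
  show "mod_null M (mod_null M S) \<subseteq> mod_null M S"
  proof
    fix A assume "A \<in> mod_null M (mod_null M S)"
    then obtain B C where A: "A \<in> sets M" and C: "C \<in> S"
      and n: "sym_diff A B \<in> null_sets M" "sym_diff B C \<in> null_sets M"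
      by (auto simp: mod_null_def)
    have "sym_diff A C \<in> null_sets M"
      by (rule null_sets_subset[OF null_sets.Un[OF n]]) (use A C assms in auto)
    with A C show "A \<in> mod_null M S" by (rule mod_nullI)
  qed
qed

lemma sigma_algebra_mod_null_sigma_sets:
  assumes "U \<subseteq> sets M"
  shows "sigma_algebra (space M) (mod_null M (sigma_sets (space M) U))"
proof -
  have U: "U \<subseteq> Pow (space M)" using assms sets.space_closed by blast
  have "subalgebra M (sigma (space M) U)"
    using U sets.sigma_sets_subset[OF assms] by (simp add: subalgebra_def)
  from sigma_algebra_mod_null[OF this] show ?thesis using U by simp
qed

section \<open>Images of Borel sets under a p.m.p. action\<close>

lemma pmp_action_inj_on:
  assumes "pmp_action M G \<phi>" "g \<in> carrier G"
  shows "inj_on (\<phi> g) (space M)"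
  using group_action.inj_prop[of G "space M" \<phi> g] assms by (simp add: pmp_action_def)

lemma pmp_action_surj:
  assumes "pmp_action M G \<phi>" "g \<in> carrier G"
  shows "\<phi> g ` space M = space M"
  using group_action.surj_prop[of G "space M" \<phi> g] assms by (simp add: pmp_action_def)

text \<open>Measurability and \<open>distr\<close> speak of preimages, invariance of images; passing
  to the inverse element translates between the two.\<close>

lemma pmp_action_image_eq_vimage:
  assumes p: "pmp_action M G \<phi>" and g: "g \<in> carrier G" and A: "A \<subseteq> space M"
  shows "\<phi> g ` A = \<phi> (inv\<^bsub>G\<^esub> g) -` A \<inter> space M"
proof -
  interpret group_action G "space M" \<phi> using p by (simp add: pmp_action_def)
  interpret G: group G by (rule group_hom.axioms(1)[OF group_hom])
  have gi: "inv\<^bsub>G\<^esub> g \<in> carrier G" using g by simp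
  show ?thesis
  proof (intro equalityI subsetI)
    fix x assume "x \<in> \<phi> g ` A"
    then obtain a where a: "a \<in> A" "x = \<phi> g a" by auto
    then have "\<phi> (inv\<^bsub>G\<^esub> g) x = a" using orbit_sym_aux[OF g, of a] A by auto
    then show "x \<in> \<phi> (inv\<^bsub>G\<^esub> g) -` A \<inter> space M"
      using a A element_image[OF g, of a x] by auto
  next
    fix x assume x: "x \<in> \<phi> (inv\<^bsub>G\<^esub> g) -` A \<inter> space M"
    then have "\<phi> g (\<phi> (inv\<^bsub>G\<^esub> g) x) = x"
      using orbit_sym_aux[OF gi, of x "\<phi> (inv\<^bsub>G\<^esub> g) x"] g by auto
    with x show "x \<in> \<phi> g ` A" by (metis IntD1 image_eqI vimageD)
  qed
qed

lemma pmp_action_inv: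
  assumes p: "pmp_action M G \<phi>" and g: "g \<in> carrier G"
  shows "\<phi> (inv\<^bsub>G\<^esub> g) \<in> measurable M M" "distr M M (\<phi> (inv\<^bsub>G\<^esub> g)) = M"
proof -
  interpret group_action G "space M" \<phi> using p by (simp add: pmp_action_def)
  interpret G: group G by (rule group_hom.axioms(1)[OF group_hom])
  have "inv\<^bsub>G\<^esub> g \<in> carrier G" using g by simp
  then show "\<phi> (inv\<^bsub>G\<^esub> g) \<in> measurable M M" "distr M M (\<phi> (inv\<^bsub>G\<^esub> g)) = M"
    using p by (auto simp: pmp_action_def)
qed

lemma pmp_action_image_sets:
  assumes "pmp_action M G \<phi>" "g \<in> carrier G" "A \<in> sets M"
  shows "\<phi> g ` A \<in> sets M"
  using pmp_action_image_eq_vimage[OF assms(1,2) sets.sets_into_space[OF assms(3)]]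
    measurable_sets[OF pmp_action_inv(1)[OF assms(1,2)] assms(3)] by simp

lemma pmp_action_image_null_sets:
  assumes "pmp_action M G \<phi>" "g \<in> carrier G" "A \<in> null_sets M"
  shows "\<phi> g ` A \<in> null_sets M"
proof -
  have A: "A \<in> sets M" using assms(3) by auto
  have "emeasure M (\<phi> g ` A) = emeasure (distr M M (\<phi> (inv\<^bsub>G\<^esub> g))) A"
    using pmp_action_image_eq_vimage[OF assms(1,2) sets.sets_into_space[OF A]]
    by (simp add: emeasure_distr[OF pmp_action_inv(1)[OF assms(1,2)] A])
  then show ?thesis
    using pmp_action_inv(2)[OF assms(1,2)] assms(3) pmp_action_image_sets[OF assms(1,2) A]
    by (auto simp: null_sets_def)
qed

text \<open>Two null errors arise, from replacing \<open>A\<close> by a member \<open>B\<close> of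
  \<open>S\<close> and from the image of \<open>B\<close> lying in \<open>S\<close> only modulo null
  sets. The action preserves null sets, and \<open>mod_null_idem\<close> absorbs both.\<close>

lemma pmp_action_image_mod_null:
  assumes p: "pmp_action M G \<phi>" and g: "g \<in> carrier G" and S: "S \<subseteq> sets M"
    and img: "\<And>B. B \<in> S \<Longrightarrow> \<phi> g ` B \<in> mod_null M S" and A: "A \<in> mod_null M S"
  shows "\<phi> g ` A \<in> mod_null M S"
proof -
  obtain B where A: "A \<in> sets M" and B: "B \<in> S" and n: "sym_diff A B \<in> null_sets M"
    using A by (auto simp: mod_null_def)
  have sp: "A \<subseteq> space M" "B \<subseteq> space M"
    using A B S sets.sets_into_space by blast+
  have "sym_diff (\<phi> g ` A) (\<phi> g ` B) = \<phi> g ` sym_diff A B"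
    using inj_on_image_set_diff[OF pmp_action_inj_on[OF p g]] sp by (simp add: image_Un subset_iff)
  then have "sym_diff (\<phi> g ` A) (\<phi> g ` B) \<in> null_sets M"
    using pmp_action_image_null_sets[OF p g n] by simp
  then have "\<phi> g ` A \<in> mod_null M (mod_null M S)"
    by (rule mod_nullI[OF pmp_action_image_sets[OF p g A] img[OF B]])
  then show ?thesis using mod_null_idem[OF S] by simp
qed

text \<open>Each \<open>\<phi> g\<close> is a bijection of the space, so taking images commutes with
  complements and countable unions, and induction over \<open>sigma_sets\<close> carries the
  property from the generators to all members.\<close>

lemma invariant_mod_null_sigma_sets:
  assumes p: "pmp_action M G \<phi>" and U: "U \<subseteq> sets M"
    and img: "\<And>g A. g \<in> carrier G \<Longrightarrow> A \<in> U \<Longrightarrow>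
      \<phi> g ` A \<in> mod_null M (sigma_sets (space M) U)"
  shows "invariant_collection G \<phi> (mod_null M (sigma_sets (space M) U))"
  unfolding invariant_collection_def
proof (intro ballI)
  fix g A assume g: "g \<in> carrier G" and A: "A \<in> mod_null M (sigma_sets (space M) U)"
  interpret S: sigma_algebra "space M" "mod_null M (sigma_sets (space M) U)"
    by (rule sigma_algebra_mod_null_sigma_sets[OF U])
  have sub: "sigma_sets (space M) U \<subseteq> sets M" by (rule sets.sigma_sets_subset[OF U])
  have "\<phi> g ` B \<in> mod_null M (sigma_sets (space M) U)" if "B \<in> sigma_sets (space M) U" for B
    using that
  proof induction
    case (Basic B)
    then show ?case by (rule img[OF g])
  next
    case Empty
    show ?case by simp
  next
    case (Compl B)
    have "B \<subseteq> space M" using Compl(1) sub sets.sets_into_space by blast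
    then have "\<phi> g ` (space M - B) = space M - \<phi> g ` B"
      using inj_on_image_set_diff[OF pmp_action_inj_on[OF p g], of "space M" B]
        pmp_action_surj[OF p g] by auto
    then show ?case using S.compl_sets[OF Compl(2)] by simp
  next
    case (Union B)
    then show ?case by (auto simp: image_UN)
  qed
  then show "\<phi> g ` A \<in> mod_null M (sigma_sets (space M) U)"
    by (rule pmp_action_image_mod_null[OF p g sub _ A])
qed

section \<open>The smallest invariant \<sigma>-algebra\<close>

lemma sigma_alg_minimal:
  assumes "sigma_algebra (space M) S" "S \<subseteq> sets M" "\<xi> \<subseteq> S" "invariant_collection G \<phi> S"
  shows "sigma_alg M G \<phi> \<xi> \<subseteq> S"
  using assms by (auto simp: sigma_alg_def)

lemma sigma_alg_superset: "\<xi> \<subseteq> sigma_alg M G \<phi> \<xi>"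
  by (auto simp: sigma_alg_def)

lemma invariant_sigma_alg: "invariant_collection G \<phi> (sigma_alg M G \<phi> \<xi>)"
  by (auto simp: sigma_alg_def invariant_collection_def)

text \<open>The intersection is over a nonempty family: \<open>sets M\<close> is itself a candidate,
  as the action maps Borel sets to Borel sets.\<close>

lemma sigma_alg_subset_sets:
  assumes "pmp_action M G \<phi>" "\<xi> \<subseteq> sets M"
  shows "sigma_alg M G \<phi> \<xi> \<subseteq> sets M"
  by (rule sigma_alg_minimal)
    (use assms pmp_action_image_sets in \<open>auto simp: invariant_collection_def sets.sigma_algebra_axioms\<close>)

section \<open>Transfer of invariance between the two actions\<close>

text \<open>The pieces \<open>Z g\<close> cover the space only up to a null set, so the piecewise
  formula gives the image up to a null set; saturation of \<open>S\<close> turns this into exact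
  membership.\<close>

lemma expressible_image:
  assumes p: "pmp_action M G \<phi>" and cG: "countable (carrier G)"
    and q: "pmp_action M H \<psi>" and h: "h \<in> carrier H"
    and S: "sigma_algebra (space M) S" "S \<subseteq> sets M" "mod_null M S = S"
      "mod_null M (sets F) \<subseteq> S" "invariant_collection G \<phi> S"
    and e: "expressible M G \<phi> F (space M) (\<psi> h)" and A: "A \<in> S"
  shows "\<psi> h ` A \<in> S"
proof -
  interpret S: sigma_algebra "space M" S by fact
  obtain Z where Z: "\<And>g. g \<in> carrier G \<Longrightarrow> Z g \<in> mod_null M (sets F)"
    and n: "space M - (\<Union>g\<in>carrier G. Z g) \<in> null_sets M"
    and eq: "\<And>g x. g \<in> carrier G \<Longrightarrow> x \<in> Z g \<Longrightarrow> \<psi> h x = \<phi> g x"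
    using e unfolding expressible_def by blast
  have AM: "A \<in> sets M" using A S(2) by auto
  let ?B = "\<Union>g\<in>carrier G. \<phi> g ` (A \<inter> Z g)"
  have BS: "?B \<in> S"
  proof (rule S.countable_UN''[OF cG])
    fix g assume g: "g \<in> carrier G"
    then have "A \<inter> Z g \<in> S" using A Z S(4) by auto
    then show "\<phi> g ` (A \<inter> Z g) \<in> S" using g S(5) by (auto simp: invariant_collection_def)
  qed
  have "?B = (\<Union>g\<in>carrier G. \<psi> h ` (A \<inter> Z g))"
    using eq by (intro SUP_cong image_cong) auto
  also have "\<dots> = \<psi> h ` (A \<inter> (\<Union>g\<in>carrier G. Z g))" by (simp only: Int_UN_distrib image_UN)
  finally have "?B = \<dots>" .
  \<comment> \<open>With \<open>E\<close> the union of the pieces, the error is confined to the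
    image of the uncovered null set, which \<open>\<psi> h\<close> keeps null.\<close>
  moreover have "sym_diff (f ` A) (f ` (A \<inter> E)) \<subseteq> f ` (space M - E)" for f :: "'a \<Rightarrow> 'a" and E
    using sets.sets_into_space[OF AM] by blast
  ultimately have "sym_diff (\<psi> h ` A) ?B \<subseteq> \<psi> h ` (space M - (\<Union>g\<in>carrier G. Z g))"
    by simp
  then have "sym_diff (\<psi> h ` A) ?B \<in> null_sets M"
    using pmp_action_image_sets[OF q h AM] BS S(2)
    by (intro null_sets_subset[OF pmp_action_image_null_sets[OF q h n]]) auto
  from mod_nullI[OF pmp_action_image_sets[OF q h AM] BS this] show ?thesis
    using S(3) by simp
qed

text \<open>One half of the comparison; exchanging the two actions gives the other.\<close>

lemma mod_null_sigma_join_le: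
  assumes p: "pmp_action M G \<phi>" and cG: "countable (carrier G)" and q: "pmp_action M H \<psi>"
    and F: "subalgebra M F" and inv: "invariant_collection G \<phi> (mod_null M (sets F))"
    and e: "\<And>h. h \<in> carrier H \<Longrightarrow> expressible M G \<phi> F (space M) (\<psi> h)"
    and \<alpha>: "\<alpha> \<subseteq> sets M"
  shows "mod_null M (sigma_join M (sigma_alg M H \<psi> \<alpha>) (sets F))
    \<subseteq> mod_null M (sigma_join M (sigma_alg M G \<phi> \<alpha>) (sets F))"
proof -
  define U where "U = sigma_alg M G \<phi> \<alpha> \<union> sets F"
  \<comment> \<open>Saturating first yields a \<sigma>-algebra that is invariant pointwise, as
    \<open>sigma_alg_minimal\<close> demands.\<close>
  define S where "S = mod_null M (sigma_sets (space M) U)"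
  have UM: "U \<subseteq> sets M"
    using sigma_alg_subset_sets[OF p \<alpha>] F by (auto simp: U_def subalgebra_def)
  have sM: "sigma_sets (space M) U \<subseteq> sets M" by (rule sets.sigma_sets_subset[OF UM])
  have Usub: "U \<subseteq> sigma_sets (space M) U" by auto
  have US: "U \<subseteq> S" unfolding S_def using subset_mod_null[OF sM] Usub by blast
  have FS: "mod_null M (sets F) \<subseteq> S"
    unfolding S_def by (rule mod_null_mono) (use Usub in \<open>auto simp: U_def\<close>)
  have SA: "sigma_algebra (space M) S"
    unfolding S_def by (rule sigma_algebra_mod_null_sigma_sets[OF UM])
  have SM: "S \<subseteq> sets M" unfolding S_def by (rule mod_null_subset_sets)
  have Sid: "mod_null M S = S" unfolding S_def by (rule mod_null_idem[OF sM])
  have invS: "invariant_collection G \<phi> S"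
    unfolding S_def
  proof (rule invariant_mod_null_sigma_sets[OF p UM])
    fix g A assume g: "g \<in> carrier G" and "A \<in> U"
    then consider "A \<in> sigma_alg M G \<phi> \<alpha>" | "A \<in> sets F" by (auto simp: U_def)
    then have "\<phi> g ` A \<in> S"
    proof cases
      case 1
      then have "\<phi> g ` A \<in> U"
        using g invariant_sigma_alg[of G \<phi> M \<alpha>] by (simp add: invariant_collection_def U_def)
      then show ?thesis using US by auto
    next
      \<comment> \<open>The image of \<open>A\<close> may leave \<open>sets F\<close>, since
        \<open>F\<close> is invariant only modulo null sets, but it stays in the saturation of
        \<open>sets F\<close>, hence in \<open>S\<close>.\<close>
      case 2
      then have "A \<in> mod_null M (sets F)"
        using subset_mod_null F by (auto simp: subalgebra_def)
      then show ?thesis using g inv FS by (auto simp: invariant_collection_def)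
    qed
    then show "\<phi> g ` A \<in> mod_null M (sigma_sets (space M) U)" by (simp add: S_def)
  qed
  have "sigma_alg M H \<psi> \<alpha> \<subseteq> S"
  proof (rule sigma_alg_minimal[OF SA SM])
    show "\<alpha> \<subseteq> S" using sigma_alg_superset[of \<alpha> M G \<phi>] US by (auto simp: U_def)
    show "invariant_collection H \<psi> S"
      using expressible_image[OF p cG q _ SA SM Sid FS invS e]
      by (auto simp: invariant_collection_def)
  qed
  then have "sigma_join M (sigma_alg M H \<psi> \<alpha>) (sets F) \<subseteq> S"
    unfolding sigma_join_def using US
    by (intro sigma_algebra.sigma_sets_subset[OF SA]) (auto simp: U_def)
  from mod_null_mono[OF this, of M] show ?thesis
    unfolding Sid by (simp only: S_def U_def sigma_join_def)
qed

theorem proposition3p4: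
  fixes M F :: "'x measure"
    and G :: "('g, 'a) monoid_scheme" and \<phi> :: "'g \<Rightarrow> 'x \<Rightarrow> 'x"
    and \<Gamma> :: "('h, 'b) monoid_scheme" and \<psi> :: "'h \<Rightarrow> 'x \<Rightarrow> 'x"
  assumes "standard_prob_space M"
    and "group G" and "countable (carrier G)"
    and "group \<Gamma>" and "countable (carrier \<Gamma>)"
    and "pmp_action M G \<phi>" and "ergodic_action M G \<phi>"
    and "pmp_action M \<Gamma> \<psi>" and "ergodic_action M \<Gamma> \<psi>"
    and "same_orbits M G \<phi> \<Gamma> \<psi>"
    and "subalgebra M F"
    and "invariant_collection G \<phi> (mod_null M (sets F))"
    and "invariant_collection \<Gamma> \<psi> (mod_null M (sets F))"
    and "\<And>g. g \<in> carrier G \<Longrightarrow> expressible M \<Gamma> \<psi> F (space M) (\<phi> g)"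
    and "\<And>\<gamma>. \<gamma> \<in> carrier \<Gamma> \<Longrightarrow> expressible M G \<phi> F (space M) (\<psi> \<gamma>)"
  shows "rokhlin_entropy M G \<phi> F = rokhlin_entropy M \<Gamma> \<psi> F"
proof -
  have "eq_mod_null M (sigma_join M (sigma_alg M G \<phi> \<alpha>) (sets F)) (sets M) \<longleftrightarrow>
      eq_mod_null M (sigma_join M (sigma_alg M \<Gamma> \<psi> \<alpha>) (sets F)) (sets M)"
    if "partition_mod_null M \<alpha>" for \<alpha>
  proof -
    have \<alpha>: "\<alpha> \<subseteq> sets M" using that by (simp add: partition_mod_null_def)
    have "mod_null M (sigma_join M (sigma_alg M G \<phi> \<alpha>) (sets F)) =
        mod_null M (sigma_join M (sigma_alg M \<Gamma> \<psi> \<alpha>) (sets F))"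
      using mod_null_sigma_join_le[OF assms(6,3,8,11,12,15) \<alpha>]
        mod_null_sigma_join_le[OF assms(8,5,6,11,13,14) \<alpha>] by blast
    then show ?thesis by (simp add: eq_mod_null_def)
  qed
  then show ?thesis
    \<comment> \<open>Both infima are of the same function over the same set of partitions, so no
      value of \<open>cond_entropy\<close> has to be computed.\<close>
    unfolding rokhlin_entropy_def by (intro arg_cong[where f = Inf] image_cong) auto
qed

end
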